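(* For every complex Banach space $X$, $X$ is isometric to a $1$-complemented subspace of $\mathcal G_0(B_X)$.
   Context: $B_X$ is the open unit ball of $X$. $\mathcal HL_0(B_X)$ is the Banach space of holomorphic Lipschitz functions $f:B_X\to\mathbb C$ with $f(0)=0$, normed by the Lipschitz constant $L(f)$. With $\tau_0$ the compact-open topology (uniform convergence on compact subsets of $B_X$), $\mathcal G_0(B_X)=\{\varphi\in\mathcal HL_0(B_X)^*: \varphi \text{ restricted to } \{f:L(f)\le1\}\text{ is }\tau_0\text{-continuous}\}$, with the norm of $\mathcal HL_0(B_X)^*$. "Isometric" means linearly isometric. A subspace is $1$-complemented if it is the range of a linear projection of norm at most $1$. *)

theory Defs
  imports "HOL-Analysis.Analysis"
begin

section \<open>Complex normed spaces and Banach spaces\<close>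

text \<open>The real scalar multiplication and the norm are those of the library classes, so that
  limits, derivatives and operator norms of the library apply unchanged.\<close>

class scaleC =
  fixes scaleC :: "complex \<Rightarrow> 'a \<Rightarrow> 'a" (infixr \<open>*\<^sub>C\<close> 75)

class complex_vector = real_vector + scaleC +
  assumes scaleC_add_right: "a *\<^sub>C (x + y) = a *\<^sub>C x + a *\<^sub>C y"
    and scaleC_add_left: "(a + b) *\<^sub>C x = a *\<^sub>C x + b *\<^sub>C x"
    and scaleC_scaleC: "a *\<^sub>C (b *\<^sub>C x) = (a * b) *\<^sub>C x"
    and scaleC_one: "1 *\<^sub>C x = x"
    and scaleR_scaleC: "r *\<^sub>R x = complex_of_real r *\<^sub>C x"

class complex_normed_vector = complex_vector + real_normed_vector +
  assumes norm_scaleC: "norm (a *\<^sub>C x) = cmod a * norm x"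

class complex_banach = complex_normed_vector + banach

global_interpretation complex_vector:
  vector_space "scaleC :: complex \<Rightarrow> 'a \<Rightarrow> 'a::complex_vector"
  defines csubspace = complex_vector.subspace
  by unfold_locales (simp_all add: scaleC_add_right scaleC_add_left scaleC_scaleC scaleC_one)

abbreviation clinear :: "('a::complex_vector \<Rightarrow> 'b::complex_vector) \<Rightarrow> bool"
  where "clinear \<equiv> Vector_Spaces.linear scaleC scaleC"

lemma clinear_iff:
  "clinear f \<longleftrightarrow> (\<forall>x y. f (x + y) = f x + f y) \<and> (\<forall>c x. f (c *\<^sub>C x) = c *\<^sub>C f x)"
  using complex_vector.vector_space_axioms[where 'a = 'a]
    complex_vector.vector_space_axioms[where 'a = 'b]
  by (auto simp: Vector_Spaces.linear_iff)

instantiation complex :: complex_banach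
begin

definition scaleC_complex :: "complex \<Rightarrow> complex \<Rightarrow> complex"
  where "scaleC_complex a x = a * x"

instance
  by standard (simp_all add: scaleC_complex_def algebra_simps norm_mult scaleR_conv_of_real)

end

lemma bounded_linear_scaleC: "bounded_linear (\<lambda>x::'a::complex_normed_vector. c *\<^sub>C x)"
proof (rule bounded_linear_intro[where K = "cmod c"])
  show "c *\<^sub>C (r *\<^sub>R x) = r *\<^sub>R (c *\<^sub>C x)" for r and x :: 'a
    by (simp add: scaleR_scaleC scaleC_scaleC mult.commute)
qed (simp_all add: scaleC_add_right norm_scaleC mult.commute)

instantiation blinfun :: (real_normed_vector, complex_normed_vector) complex_normed_vector
begin

lift_definition scaleC_blinfun :: "complex \<Rightarrow> 'a \<Rightarrow>\<^sub>L 'b \<Rightarrow> 'a \<Rightarrow>\<^sub>L 'b" is "\<lambda>c f x. c *\<^sub>C f x"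
  by (rule bounded_linear_compose[OF bounded_linear_scaleC])

instance
proof
  fix a b :: complex and r :: real and f g :: "'a \<Rightarrow>\<^sub>L 'b"
  show "a *\<^sub>C (f + g) = a *\<^sub>C f + a *\<^sub>C g"
    by transfer (simp add: scaleC_add_right)
  show "(a + b) *\<^sub>C f = a *\<^sub>C f + b *\<^sub>C f"
    by transfer (simp add: scaleC_add_left)
  show "a *\<^sub>C (b *\<^sub>C f) = (a * b) *\<^sub>C f"
    by transfer (simp add: scaleC_scaleC)
  show "1 *\<^sub>C f = f"
    by transfer (simp add: scaleC_one)
  show "r *\<^sub>R f = complex_of_real r *\<^sub>C f"
    by transfer (simp add: scaleR_scaleC)
  have le: "norm (a *\<^sub>C f) \<le> cmod a * norm f" for a and f :: "'a \<Rightarrow>\<^sub>L 'b"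
  proof (rule norm_blinfun_bound)
    show "norm (blinfun_apply (a *\<^sub>C f) x) \<le> cmod a * norm f * norm x" for x
      using mult_left_mono[OF norm_blinfun[of f x], of "cmod a"]
      by (simp add: scaleC_blinfun.rep_eq norm_scaleC mult.assoc)
  qed simp
  show "norm (a *\<^sub>C f) = cmod a * norm f"
  proof (cases "a = 0")
    case True
    then show ?thesis using le[of a f] by simp
  next
    case False
    have "inverse a *\<^sub>C (a *\<^sub>C f) = f"
      using False by transfer (simp add: scaleC_scaleC scaleC_one)
    then have "norm f \<le> cmod (inverse a) * norm (a *\<^sub>C f)"
      using le[of "inverse a" "a *\<^sub>C f"] by simp
    then have "cmod a * norm f \<le> norm (a *\<^sub>C f)"
      using False by (simp add: norm_divide field_simps)
    with le[of a f] show ?thesis by simp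
  qed
qed

end

section \<open>Holomorphic Lipschitz functions on the open unit ball\<close>

definition cholomorphic_on ::
    "('a::complex_normed_vector \<Rightarrow> 'b::complex_normed_vector) \<Rightarrow> 'a set \<Rightarrow> bool"
  where "cholomorphic_on f U \<longleftrightarrow> (\<forall>x\<in>U. \<exists>D. clinear D \<and> (f has_derivative D) (at x))"

lemma cholomorphic_on_zero: "cholomorphic_on (\<lambda>_. 0) U"
  unfolding cholomorphic_on_def
  by (auto simp: clinear_iff intro!: exI[of _ "\<lambda>_. 0"])

definition lipschitz_const :: "('a::metric_space \<Rightarrow> 'b::metric_space) \<Rightarrow> 'a set \<Rightarrow> real"
  where "lipschitz_const f U = Inf {C. C-lipschitz_on U f}"

text \<open>A function on the open unit ball is represented by its extension by \<open>0\<close> to the whole space;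
  all conditions other than the first concern its values on the ball only.\<close>

typedef (overloaded) 'a hl0 =
  "{f :: 'a::complex_normed_vector \<Rightarrow> complex.
      (\<forall>x. x \<notin> ball 0 1 \<longrightarrow> f x = 0) \<and> f 0 = 0 \<and>
      cholomorphic_on f (ball 0 1) \<and> (\<exists>C. C-lipschitz_on (ball 0 1) f)}"
  morphisms hl0_apply Abs_hl0
  by (rule exI[of _ "\<lambda>_. 0"]) (auto intro: cholomorphic_on_zero lipschitz_on_constant)

setup_lifting type_definition_hl0

lemma cholomorphic_on_add:
  assumes "cholomorphic_on f U" "cholomorphic_on g U"
  shows "cholomorphic_on (\<lambda>x. f x + g x) U"
  unfolding cholomorphic_on_def
proof
  fix x assume "x \<in> U"
  with assms obtain D E where "clinear D" "(f has_derivative D) (at x)"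
    "clinear E" "(g has_derivative E) (at x)"
    unfolding cholomorphic_on_def by blast
  then show "\<exists>D. clinear D \<and> ((\<lambda>x. f x + g x) has_derivative D) (at x)"
    by (intro exI[of _ "\<lambda>x. D x + E x"])
      (auto simp: clinear_iff scaleC_add_right intro: has_derivative_add)
qed

lemma cholomorphic_on_scaleC:
  assumes "cholomorphic_on f U"
  shows "cholomorphic_on (\<lambda>x. c *\<^sub>C f x) U"
  unfolding cholomorphic_on_def
proof
  fix x assume "x \<in> U"
  with assms obtain D where "clinear D" "(f has_derivative D) (at x)"
    unfolding cholomorphic_on_def by blast
  then show "\<exists>D. clinear D \<and> ((\<lambda>x. c *\<^sub>C f x) has_derivative D) (at x)"
    by (intro exI[of _ "\<lambda>x. c *\<^sub>C D x"])
      (auto simp: clinear_iff scaleC_add_right scaleC_scaleC mult.commute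
        intro: bounded_linear.has_derivative[OF bounded_linear_scaleC])
qed

lemma lipschitz_on_scaleC:
  fixes f :: "'a::metric_space \<Rightarrow> 'b::complex_normed_vector"
  assumes "C-lipschitz_on U f"
  shows "(cmod c * C)-lipschitz_on U (\<lambda>x. c *\<^sub>C f x)"
proof (rule lipschitz_onI)
  fix x y assume "x \<in> U" "y \<in> U"
  interpret bounded_linear "\<lambda>x::'b. c *\<^sub>C x" by (rule bounded_linear_scaleC)
  have "dist (c *\<^sub>C f x) (c *\<^sub>C f y) = cmod c * dist (f x) (f y)"
    by (simp add: dist_norm diff[symmetric] norm_scaleC)
  then show "dist (c *\<^sub>C f x) (c *\<^sub>C f y) \<le> cmod c * C * dist x y"
    using lipschitz_onD[OF assms \<open>x \<in> U\<close> \<open>y \<in> U\<close>]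
    by (simp add: mult.assoc mult_left_mono)
qed (use lipschitz_on_nonneg[OF assms] in simp)

lemma minus_eq_scaleC: "- x = (- 1) *\<^sub>C (x::'a::complex_vector)"
  using complex_vector.scale_minus_left[of 1 x] by (simp add: scaleC_one)

lemma lipschitz_const_lipschitz_on:
  assumes "C-lipschitz_on U f"
  shows "(lipschitz_const f U)-lipschitz_on U f"
proof (rule lipschitz_onI)
  let ?S = "{C. C-lipschitz_on U f}"
  have ne: "?S \<noteq> {}" using assms by blast
  show "0 \<le> lipschitz_const f U"
    unfolding lipschitz_const_def by (rule cInf_greatest[OF ne]) (auto dest: lipschitz_on_nonneg)
  fix x y assume xy: "x \<in> U" "y \<in> U"
  show "dist (f x) (f y) \<le> lipschitz_const f U * dist x y"
  proof (cases "x = y")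
    case False
    have "dist (f x) (f y) / dist x y \<le> lipschitz_const f U"
      unfolding lipschitz_const_def
      by (rule cInf_greatest[OF ne])
        (use False xy in \<open>auto simp: divide_le_eq dest: lipschitz_onD\<close>)
    with False show ?thesis by (simp add: divide_le_eq)
  qed simp
qed

lemma lipschitz_const_le:
  assumes "C-lipschitz_on U f"
  shows "lipschitz_const f U \<le> C"
  unfolding lipschitz_const_def
  by (rule cInf_lower) (use assms in \<open>auto intro!: bdd_belowI[of _ 0] dest: lipschitz_on_nonneg\<close>)

instantiation hl0 :: (complex_normed_vector) complex_normed_vector
begin

lift_definition zero_hl0 :: "'a hl0" is "\<lambda>_. 0"
  by (auto intro: cholomorphic_on_zero lipschitz_on_constant)

lift_definition plus_hl0 :: "'a hl0 \<Rightarrow> 'a hl0 \<Rightarrow> 'a hl0" is "\<lambda>f g x. f x + g x"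
  by (auto intro: cholomorphic_on_add lipschitz_on_add)

lift_definition scaleC_hl0 :: "complex \<Rightarrow> 'a hl0 \<Rightarrow> 'a hl0" is "\<lambda>c f x. c *\<^sub>C f x"
  by (auto intro: cholomorphic_on_scaleC lipschitz_on_scaleC)

definition scaleR_hl0 :: "real \<Rightarrow> 'a hl0 \<Rightarrow> 'a hl0"
  where "scaleR_hl0 r f = complex_of_real r *\<^sub>C f"

definition uminus_hl0 :: "'a hl0 \<Rightarrow> 'a hl0"
  where "uminus_hl0 f = (- 1) *\<^sub>C f"

definition minus_hl0 :: "'a hl0 \<Rightarrow> 'a hl0 \<Rightarrow> 'a hl0"
  where "minus_hl0 f g = f + - g"

lift_definition norm_hl0 :: "'a hl0 \<Rightarrow> real" is "\<lambda>f. lipschitz_const f (ball 0 1)" .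

definition dist_hl0 :: "'a hl0 \<Rightarrow> 'a hl0 \<Rightarrow> real"
  where "dist_hl0 f g = norm (f - g)"

definition sgn_hl0 :: "'a hl0 \<Rightarrow> 'a hl0"
  where "sgn_hl0 f = inverse (norm f) *\<^sub>R f"

definition uniformity_hl0 :: "('a hl0 \<times> 'a hl0) filter"
  where "uniformity_hl0 = (INF e\<in>{0<..}. principal {(x, y). dist x y < e})"

definition open_hl0 :: "'a hl0 set \<Rightarrow> bool"
  where "open_hl0 S = (\<forall>x\<in>S. \<forall>\<^sub>F (x', y) in uniformity. x' = x \<longrightarrow> y \<in> S)"

instance
proof
  fix a b :: complex and r s :: real and f g h :: "'a hl0"
  show "f + g + h = f + (g + h)" by transfer (simp add: add.assoc)
  show "f + g = g + f" by transfer (simp add: add.commute)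
  show "0 + f = f" by transfer simp
  show "- f + f = 0" unfolding uminus_hl0_def by transfer (simp add: scaleC_complex_def)
  show "f - g = f + - g" by (rule minus_hl0_def)
  show C1: "a *\<^sub>C (f + g) = a *\<^sub>C f + a *\<^sub>C g" for a
    by transfer (simp add: scaleC_add_right)
  show C2: "(a + b) *\<^sub>C f = a *\<^sub>C f + b *\<^sub>C f" for a b
    by transfer (simp add: scaleC_add_left)
  show C3: "a *\<^sub>C (b *\<^sub>C f) = (a * b) *\<^sub>C f" for a b
    by transfer (simp add: scaleC_scaleC)
  show C4: "1 *\<^sub>C f = f" by transfer (simp add: scaleC_one)
  show "r *\<^sub>R f = complex_of_real r *\<^sub>C f" by (rule scaleR_hl0_def)
  show "r *\<^sub>R (f + g) = r *\<^sub>R f + r *\<^sub>R g" by (simp add: scaleR_hl0_def C1)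
  show "(r + s) *\<^sub>R f = r *\<^sub>R f + s *\<^sub>R f" by (simp add: scaleR_hl0_def C2)
  show "r *\<^sub>R s *\<^sub>R f = (r * s) *\<^sub>R f" by (simp add: scaleR_hl0_def C3)
  show "1 *\<^sub>R f = f" by (simp add: scaleR_hl0_def C4)
  show "dist f g = norm (f - g)" by (rule dist_hl0_def)
  show "sgn f = inverse (norm f) *\<^sub>R f" by (rule sgn_hl0_def)
  show "uniformity = (INF e\<in>{0<..}. principal {(x::'a hl0, y). dist x y < e})"
    by (rule uniformity_hl0_def)
  show "open U = (\<forall>x\<in>U. \<forall>\<^sub>F (x', y) in uniformity. x' = x \<longrightarrow> y \<in> U)" for U :: "'a hl0 set"
    by (rule open_hl0_def)
  show "norm f = 0 \<longleftrightarrow> f = 0"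
  proof transfer
    fix f :: "'a \<Rightarrow> complex"
    assume f: "(\<forall>x. x \<notin> ball 0 1 \<longrightarrow> f x = 0) \<and> f 0 = 0 \<and>
      cholomorphic_on f (ball 0 1) \<and> (\<exists>C. C-lipschitz_on (ball 0 1) f)"
    then obtain C where "C-lipschitz_on (ball 0 1) f" by blast
    note L = lipschitz_const_lipschitz_on[OF this]
    show "lipschitz_const f (ball 0 1) = 0 \<longleftrightarrow> f = (\<lambda>_. 0)"
    proof
      assume 0: "lipschitz_const f (ball 0 1) = 0"
      show "f = (\<lambda>_. 0)"
      proof
        fix x show "f x = 0"
          using lipschitz_onD[OF L, of x 0] f 0 by (cases "x \<in> ball 0 1") auto
      qed
    next
      assume "f = (\<lambda>_. 0)"
      then have "lipschitz_const f (ball 0 1) \<le> 0"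
        by (auto intro: lipschitz_const_le lipschitz_on_constant)
      with lipschitz_on_nonneg[OF L] show "lipschitz_const f (ball 0 1) = 0" by simp
    qed
  qed
  show "norm (f + g) \<le> norm f + norm g"
    by transfer (blast intro: lipschitz_const_le lipschitz_on_add lipschitz_const_lipschitz_on)
  have le: "norm (a *\<^sub>C f) \<le> cmod a * norm f" for a and f :: "'a hl0"
    by transfer (blast intro: lipschitz_const_le lipschitz_on_scaleC lipschitz_const_lipschitz_on)
  show nC: "norm (a *\<^sub>C f) = cmod a * norm f" for a
  proof (cases "a = 0")
    case True
    have "0 \<le> norm (a *\<^sub>C f)"
      by transfer
        (blast intro: lipschitz_on_nonneg lipschitz_const_lipschitz_on lipschitz_on_scaleC)
    with True show ?thesis using le[of a f] by simp
  next
    case False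
    then have "norm f \<le> cmod (inverse a) * norm (a *\<^sub>C f)"
      using le[of "inverse a" "a *\<^sub>C f"] by (simp add: C3 C4)
    then have "cmod a * norm f \<le> norm (a *\<^sub>C f)"
      using False by (simp add: norm_divide field_simps)
    with le[of a f] show ?thesis by simp
  qed
  show "norm (r *\<^sub>R f) = \<bar>r\<bar> * norm f"
    by (simp add: scaleR_hl0_def nC)
qed

end

section \<open>The compact-open topology and the canonical predual\<close>

definition hl0_tau0 :: "'a::complex_normed_vector hl0 topology"
  where "hl0_tau0 = topology (\<lambda>U. \<forall>f\<in>U. \<exists>K e. compact K \<and> K \<subseteq> ball 0 1 \<and> e > 0 \<and>
    {g. \<forall>x\<in>K. dist (hl0_apply g x) (hl0_apply f x) < e} \<subseteq> U)"

lemma openin_hl0_tau0: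
  fixes U :: "'a::complex_normed_vector hl0 set"
  shows "openin hl0_tau0 U \<longleftrightarrow> (\<forall>f\<in>U. \<exists>K e. compact K \<and> K \<subseteq> ball 0 1 \<and> e > 0 \<and>
    {g. \<forall>x\<in>K. dist (hl0_apply g x) (hl0_apply f x) < e} \<subseteq> U)"
proof -
  let ?P = "\<lambda>U f. \<exists>K e. compact K \<and> K \<subseteq> ball 0 1 \<and> e > 0 \<and>
    {g :: 'a hl0. \<forall>x\<in>K. dist (hl0_apply g x) (hl0_apply f x) < e} \<subseteq> U"
  have mono: "?P V f" if "?P U f" "U \<subseteq> V" for U V and f :: "'a hl0"
    using that by (meson order_trans)
  have int: "?P (U \<inter> V) f" if U: "?P U f" and V: "?P V f" for U V and f :: "'a hl0"
  proof -
    obtain K d where K: "compact K" "K \<subseteq> ball 0 1" "d > 0"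
      "{g. \<forall>x\<in>K. dist (hl0_apply g x) (hl0_apply f x) < d} \<subseteq> U" using U by blast
    obtain L e where L: "compact L" "L \<subseteq> ball 0 1" "e > 0"
      "{g. \<forall>x\<in>L. dist (hl0_apply g x) (hl0_apply f x) < e} \<subseteq> V" using V by blast
    show ?thesis
      by (rule exI[of _ "K \<union> L"], rule exI[of _ "min d e"])
        (use K L in \<open>auto intro: compact_Un\<close>)
  qed
  have "istopology (\<lambda>U. \<forall>f\<in>U. ?P U f)"
    unfolding istopology_def
  proof (intro conjI allI impI ballI)
    fix S T f assume "\<forall>f\<in>S. ?P S f" "\<forall>f\<in>T. ?P T f" "f \<in> S \<inter> T"
    then have "?P S f" and "?P T f" by blast+
    then show "?P (S \<inter> T) f" by (rule int)
  next
    fix \<K> f assume *: "\<forall>S\<in>\<K>. \<forall>f\<in>S. ?P S f" and "f \<in> \<Union>\<K>"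
    then obtain S where S: "S \<in> \<K>" "f \<in> S" by blast
    with * have "?P S f" by blast
    moreover have "S \<subseteq> \<Union>\<K>" using S by blast
    ultimately show "?P (\<Union>\<K>) f" by (rule mono)
  qed
  then show ?thesis
    unfolding hl0_tau0_def by (simp add: topology_inverse')
qed

text \<open>The norm of the type of bounded (real-)linear maps is the supremum of
  \<open>cmod (\<phi> f) / norm f\<close>; on complex-linear functionals this is the norm of the complex dual.\<close>

typedef (overloaded) 'a g0 =
  "{\<phi> :: 'a::complex_normed_vector hl0 \<Rightarrow>\<^sub>L complex. clinear (blinfun_apply \<phi>) \<and>
      continuous_map (subtopology hl0_tau0 {f. norm f \<le> 1}) euclidean (blinfun_apply \<phi>)}"
  morphisms blinfun_of_g0 Abs_g0
  by (rule exI[of _ 0]) (auto simp: clinear_iff zero_blinfun.rep_eq)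

setup_lifting type_definition_g0

instantiation g0 :: (complex_normed_vector) complex_normed_vector
begin

lift_definition zero_g0 :: "'a g0" is 0
  by (auto simp: clinear_iff zero_blinfun.rep_eq)

lift_definition plus_g0 :: "'a g0 \<Rightarrow> 'a g0 \<Rightarrow> 'a g0" is "(+)"
  by (auto simp: clinear_iff plus_blinfun.rep_eq scaleC_add_right intro: continuous_map_add)

lift_definition scaleC_g0 :: "complex \<Rightarrow> 'a g0 \<Rightarrow> 'a g0" is "(*\<^sub>C)"
proof -
  fix c and \<phi> :: "'a hl0 \<Rightarrow>\<^sub>L complex"
  let ?X = "subtopology hl0_tau0 {f :: 'a hl0. norm f \<le> 1}"
  assume *: "clinear (blinfun_apply \<phi>) \<and> continuous_map ?X euclidean (blinfun_apply \<phi>)"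
  have "continuous_map euclidean euclidean (\<lambda>z::complex. c *\<^sub>C z)"
    by (simp add: linear_continuous_on[OF bounded_linear_scaleC])
  then have "continuous_map ?X euclidean ((\<lambda>z. c *\<^sub>C z) \<circ> blinfun_apply \<phi>)"
    using * continuous_map_compose by blast
  with * show "clinear (blinfun_apply (c *\<^sub>C \<phi>)) \<and>
      continuous_map ?X euclidean (blinfun_apply (c *\<^sub>C \<phi>))"
    by (simp add: clinear_iff scaleC_blinfun.rep_eq scaleC_add_right scaleC_scaleC
        mult.commute o_def)
qed

definition scaleR_g0 :: "real \<Rightarrow> 'a g0 \<Rightarrow> 'a g0"
  where "scaleR_g0 r \<phi> = complex_of_real r *\<^sub>C \<phi>"

definition uminus_g0 :: "'a g0 \<Rightarrow> 'a g0"
  where "uminus_g0 \<phi> = (- 1) *\<^sub>C \<phi>"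

definition minus_g0 :: "'a g0 \<Rightarrow> 'a g0 \<Rightarrow> 'a g0"
  where "minus_g0 \<phi> \<psi> = \<phi> + - \<psi>"

lift_definition norm_g0 :: "'a g0 \<Rightarrow> real" is norm .

definition dist_g0 :: "'a g0 \<Rightarrow> 'a g0 \<Rightarrow> real"
  where "dist_g0 \<phi> \<psi> = norm (\<phi> - \<psi>)"

definition sgn_g0 :: "'a g0 \<Rightarrow> 'a g0"
  where "sgn_g0 \<phi> = inverse (norm \<phi>) *\<^sub>R \<phi>"

definition uniformity_g0 :: "('a g0 \<times> 'a g0) filter"
  where "uniformity_g0 = (INF e\<in>{0<..}. principal {(x, y). dist x y < e})"

definition open_g0 :: "'a g0 set \<Rightarrow> bool"
  where "open_g0 S = (\<forall>x\<in>S. \<forall>\<^sub>F (x', y) in uniformity. x' = x \<longrightarrow> y \<in> S)"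

instance
proof
  fix a b :: complex and r s :: real and f g h :: "'a g0"
  show "f + g + h = f + (g + h)" by transfer (simp add: add.assoc)
  show "f + g = g + f" by transfer (simp add: add.commute)
  show "0 + f = f" by transfer simp
  show "- f + f = 0"
    unfolding uminus_g0_def by transfer (simp add: minus_eq_scaleC[symmetric])
  show "f - g = f + - g" by (rule minus_g0_def)
  show C1: "a *\<^sub>C (f + g) = a *\<^sub>C f + a *\<^sub>C g" for a
    by transfer (simp add: scaleC_add_right)
  show C2: "(a + b) *\<^sub>C f = a *\<^sub>C f + b *\<^sub>C f" for a b
    by transfer (simp add: scaleC_add_left)
  show C3: "a *\<^sub>C (b *\<^sub>C f) = (a * b) *\<^sub>C f" for a b
    by transfer (simp add: scaleC_scaleC)
  show C4: "1 *\<^sub>C f = f" by transfer (simp add: scaleC_one)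
  show "r *\<^sub>R f = complex_of_real r *\<^sub>C f" by (rule scaleR_g0_def)
  show "r *\<^sub>R (f + g) = r *\<^sub>R f + r *\<^sub>R g" by (simp add: scaleR_g0_def C1)
  show "(r + s) *\<^sub>R f = r *\<^sub>R f + s *\<^sub>R f" by (simp add: scaleR_g0_def C2)
  show "r *\<^sub>R s *\<^sub>R f = (r * s) *\<^sub>R f" by (simp add: scaleR_g0_def C3)
  show "1 *\<^sub>R f = f" by (simp add: scaleR_g0_def C4)
  show "dist f g = norm (f - g)" by (rule dist_g0_def)
  show "sgn f = inverse (norm f) *\<^sub>R f" by (rule sgn_g0_def)
  show "uniformity = (INF e\<in>{0<..}. principal {(x::'a g0, y). dist x y < e})"
    by (rule uniformity_g0_def)
  show "open U = (\<forall>x\<in>U. \<forall>\<^sub>F (x', y) in uniformity. x' = x \<longrightarrow> y \<in> U)" for U :: "'a g0 set"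
    by (rule open_g0_def)
  show "norm f = 0 \<longleftrightarrow> f = 0" by transfer simp
  show "norm (f + g) \<le> norm f + norm g" by transfer (rule norm_triangle_ineq)
  show nC: "norm (a *\<^sub>C f) = cmod a * norm f" for a by transfer (rule norm_scaleC)
  show "norm (r *\<^sub>R f) = \<bar>r\<bar> * norm f" by (simp add: scaleR_g0_def nC)
qed

end

section \<open>Isometric copies and complemented subspaces\<close>

text \<open>The first argument only names the space, which is the whole type.\<close>

definition isometric_to :: "'a::complex_normed_vector itself \<Rightarrow> 'b::complex_normed_vector set \<Rightarrow> bool"
  where "isometric_to (_ :: 'a itself) M \<longleftrightarrow>
    (\<exists>J :: 'a \<Rightarrow> 'b. clinear J \<and> (\<forall>x. norm (J x) = norm x) \<and> range J = M)"

definition one_complemented :: "'b::complex_normed_vector set \<Rightarrow> bool"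
  where "one_complemented M \<longleftrightarrow>
    (\<exists>P. clinear P \<and> (\<forall>y. P (P y) = P y) \<and> (\<forall>y. norm (P y) \<le> norm y) \<and> range P = M)"

end

theory Submission
  imports Defs "HOL-Complex_Analysis.Cauchy_Integral_Formula"
begin

text \<open>The embedding sends \<open>x\<close> to the functional \<open>f \<mapsto> df(0)(x)\<close>. Cauchy's estimate on the complex
  line through \<open>x\<close> controls \<open>df(0)(x)\<close> by the values of \<open>f\<close> on a small circle in that line. Applied
  to the Lipschitz bound of \<open>f\<close> it shows that the embedding does not increase norms; applied to a
  difference \<open>g - f\<close> that is small on a compact disc it shows that the functional is continuous for
  the compact-open topology (\<open>deriv0_cauchy_bound\<close>, \<open>continuous_map_deriv0\<close>).

  In the other direction, an element \<open>\<phi>\<close> of the predual is restricted to the functions that are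
  linear on the ball, that is, to the dual of \<open>X\<close>. This restriction is evaluation at a point \<open>T \<phi>\<close>
  of \<open>X\<close> (\<open>g0_represented_on_linear_hl0\<close>), for the following reason. Given \<open>e > 0\<close>, continuity of
  \<open>\<phi>\<close> on the unit ball and compactness give a finite set \<open>F\<close> such that \<open>\<bar>\<phi> f\<bar> \<le> e * norm f\<close>
  whenever \<open>f\<close> vanishes on \<open>F\<close>. By the Hahn-Banach theorem the restriction of \<open>\<phi>\<close> to these \<open>f\<close>
  extends to a functional \<open>\<psi>\<close> of norm at most \<open>e\<close>; and \<open>\<phi> - \<psi>\<close>, which vanishes where all
  evaluations at points of \<open>F\<close> vanish, is a linear combination of these evaluations, so on linear
  functions it is the evaluation at one vector. Hence \<open>\<phi>\<close> is approximated on the dual of \<open>X\<close>, in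
  norm, by evaluations; norming functionals make the approximating vectors a Cauchy sequence, and
  completeness of \<open>X\<close> gives the limit.

  Since a linear function is its own differential at \<open>0\<close>, \<open>T\<close> is a left inverse of the embedding.
  Norming functionals show that \<open>T\<close> does not increase norms either, so the embedding is isometric,
  and the embedding composed with \<open>T\<close> is the required projection.\<close>

section \<open>The Hahn-Banach theorem\<close>

definition sublinear :: "('v::real_vector \<Rightarrow> real) \<Rightarrow> bool"
  where "sublinear p \<longleftrightarrow>
    (\<forall>x y. p (x + y) \<le> p x + p y) \<and> (\<forall>r x. r > 0 \<longrightarrow> p (r *\<^sub>R x) \<le> r * p x)"

lemma sublinearI:
  assumes "\<And>x y. p (x + y) \<le> p x + p y" "\<And>r x. r > 0 \<Longrightarrow> p (r *\<^sub>R x) \<le> r * p x"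
  shows "sublinear p"
  using assms unfolding sublinear_def by blast

lemma sublinear_add: "sublinear p \<Longrightarrow> p (x + y) \<le> p x + p y"
  unfolding sublinear_def by blast

lemma sublinear_scale_le: "sublinear p \<Longrightarrow> r > 0 \<Longrightarrow> p (r *\<^sub>R x) \<le> r * p x"
  unfolding sublinear_def by simp

lemma sublinear_zero: "sublinear p \<Longrightarrow> p 0 = 0"
  using sublinear_add[of p 0 0] sublinear_scale_le[of p "1 / 2" 0] by simp

lemma sublinear_scale:
  assumes "sublinear p" "r > 0"
  shows "p (r *\<^sub>R x) = r * p x"
proof (rule antisym)
  show "p (r *\<^sub>R x) \<le> r * p x" by (rule sublinear_scale_le[OF assms])
  have "p (inverse r *\<^sub>R (r *\<^sub>R x)) \<le> inverse r * p (r *\<^sub>R x)"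
    by (rule sublinear_scale_le) (use assms in auto)
  then show "r * p x \<le> p (r *\<^sub>R x)" using assms(2) by (simp add: field_simps)
qed

lemma sublinear_minus: "sublinear p \<Longrightarrow> - p (- x) \<le> p x"
  using sublinear_add[of p x "- x"] sublinear_zero[of p] by simp

text \<open>The infimum \<open>q x = inf {p (x + c) - f c | c \<in> C}\<close> is bounded below by \<open>- p (- x)\<close> because \<open>f \<le> p\<close>
  on the cone. Every linear \<open>g \<le> q\<close> satisfies \<open>g \<ge> f\<close> on \<open>C\<close>, as one sees at \<open>x = - c\<close>. With a subspace
  for \<open>C\<close> this turns extension of functionals into mere domination; with a ray for \<open>C\<close> it yields
  both the linearity of minimal sublinear functions and the norming functionals.\<close>

lemma sublinear_cone_infimum:
  fixes p :: "'v::real_vector \<Rightarrow> real"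
  assumes p: "sublinear p"
    and zero: "0 \<in> C" and add: "\<And>x y. x \<in> C \<Longrightarrow> y \<in> C \<Longrightarrow> x + y \<in> C"
    and scale: "\<And>r x. r > 0 \<Longrightarrow> x \<in> C \<Longrightarrow> r *\<^sub>R x \<in> C"
    and f_add: "\<And>x y. x \<in> C \<Longrightarrow> y \<in> C \<Longrightarrow> f x + f y \<le> f (x + y)"
    and f_scale: "\<And>r x. r > 0 \<Longrightarrow> x \<in> C \<Longrightarrow> f (r *\<^sub>R x) = r * f x"
    and f_zero: "f 0 = 0" and f_le: "\<And>x. x \<in> C \<Longrightarrow> f x \<le> p x"
  obtains q where "sublinear q" "\<And>x. q x \<le> p x" "\<And>x c. c \<in> C \<Longrightarrow> q x \<le> p (x + c) - f c"
proof
  define q where "q x = (INF c\<in>C. p (x + c) - f c)" for x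
  have bdd: "bdd_below ((\<lambda>c. p (x + c) - f c) ` C)" for x
  proof (rule bdd_belowI2)
    fix c assume "c \<in> C"
    have "p c \<le> p (x + c) + p (- x)" using sublinear_add[OF p, of "x + c" "- x"] by simp
    with f_le[OF \<open>c \<in> C\<close>] show "- p (- x) \<le> p (x + c) - f c" by linarith
  qed
  show upper: "q x \<le> p (x + c) - f c" if "c \<in> C" for x c
    unfolding q_def by (rule cINF_lower[OF bdd that])
  have lower: "m \<le> q x" if "\<And>c. c \<in> C \<Longrightarrow> m \<le> p (x + c) - f c" for m x
    unfolding q_def by (rule cINF_greatest) (use zero that in auto)
  show "q x \<le> p x" for x
    using upper[OF zero, of x] f_zero by simp
  show "sublinear q"
  proof (rule sublinearI)
    fix x y
    have "q (x + y) - q y \<le> p (x + c) - f c" if c: "c \<in> C" for c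
    proof -
      have "q (x + y) - (p (x + c) - f c) \<le> p (y + d) - f d" if d: "d \<in> C" for d
      proof -
        have "q (x + y) \<le> p ((x + y) + (c + d)) - f (c + d)" by (rule upper[OF add[OF c d]])
        also have "(x + y) + (c + d) = (x + c) + (y + d)" by simp
        also have "p \<dots> \<le> p (x + c) + p (y + d)" by (rule sublinear_add[OF p])
        finally show ?thesis using f_add[OF c d] by linarith
      qed
      from lower[OF this] show ?thesis by linarith
    qed
    from lower[OF this] show "q (x + y) \<le> q x + q y" by linarith
  next
    fix r :: real and x :: 'v assume r: "r > 0"
    have "q (r *\<^sub>R x) / r \<le> p (x + c) - f c" if c: "c \<in> C" for c
    proof -
      have "q (r *\<^sub>R x) \<le> p (r *\<^sub>R (x + c)) - f (r *\<^sub>R c)"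
        using upper[OF scale[OF r c], of "r *\<^sub>R x"] by (simp add: scaleR_add_right)
      also have "\<dots> = r * (p (x + c) - f c)"
        by (simp add: sublinear_scale[OF p r] f_scale[OF r c] right_diff_distrib)
      finally show ?thesis using r by (simp add: field_simps)
    qed
    from lower[OF this] r show "q (r *\<^sub>R x) \<le> r * q x" by (simp add: field_simps)
  qed
qed

lemma sublinear_ray_infimum:
  fixes p :: "'v::real_vector \<Rightarrow> real"
  assumes p: "sublinear p"
  obtains q where "sublinear q" "\<And>x. q x \<le> p x" "\<And>x. q x \<le> p (x + a) - p a"
proof -
  let ?C = "{t *\<^sub>R a |t. t \<ge> 0}"
  have lin: "p (t *\<^sub>R a) = t * p a" if "t \<ge> 0" for t
    using sublinear_scale[OF p, of t a] sublinear_zero[OF p] that by (cases "t = 0") auto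
  have C_add: "\<exists>w. s *\<^sub>R a + t *\<^sub>R a = w *\<^sub>R a \<and> w \<ge> 0" if "s \<ge> 0" "t \<ge> 0" for s t
    using that by (intro exI[of _ "s + t"]) (simp add: scaleR_add_left)
  have C_scale: "\<exists>w. (r *\<^sub>R t *\<^sub>R a) = w *\<^sub>R a \<and> w \<ge> 0" if "r > 0" "t \<ge> 0" for r t
    using that by (intro exI[of _ "r * t"]) simp
  obtain q where q: "sublinear q" "\<And>x. q x \<le> p x" "\<And>x c. c \<in> ?C \<Longrightarrow> q x \<le> p (x + c) - p c"
  proof (rule sublinear_cone_infimum[OF p, of ?C p])
    show "0 \<in> ?C" by force
    show "x + y \<in> ?C" if "x \<in> ?C" "y \<in> ?C" for x y using that C_add by auto
    show "r *\<^sub>R x \<in> ?C" if "r > 0" "x \<in> ?C" for r x using that C_scale by auto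
    show "p x + p y \<le> p (x + y)" if "x \<in> ?C" "y \<in> ?C" for x y
    proof -
      from that obtain s t where st: "x = s *\<^sub>R a" "s \<ge> 0" "y = t *\<^sub>R a" "t \<ge> 0" by blast
      then have "p (x + y) = (s + t) * p a" using lin[of "s + t"] by (simp add: scaleR_add_left)
      with st show ?thesis by (simp add: lin algebra_simps)
    qed
    show "p (r *\<^sub>R x) = r * p x" if "r > 0" for r x by (rule sublinear_scale[OF p that])
  qed (simp_all add: sublinear_zero[OF p])
  have "1 *\<^sub>R a \<in> ?C" by (intro CollectI exI conjI) (rule refl, simp)
  then have "a \<in> ?C" by simp
  from that[OF q(1,2) q(3)[OF this]] show thesis .
qed

text \<open>A minimal sublinear function below \<open>p\<close> exists by Zorn's lemma, and it is linear: by minimality it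
  equals its own infimum along the ray through any \<open>a\<close>, which gives \<open>m x \<le> m (x + a) - m a\<close>, the
  reverse of subadditivity.\<close>

lemma ex_linear_le_sublinear:
  fixes p :: "'v::real_vector \<Rightarrow> real"
  assumes p: "sublinear p"
  shows "\<exists>g. linear g \<and> (\<forall>x. g x \<le> p x)"
proof -
  define A where "A = {q. sublinear q \<and> (\<forall>x. q x \<le> p x)}"
  let ?R = "relation_of (\<lambda>q q' :: 'v \<Rightarrow> real. q' \<le> q) A"
  have "\<exists>m\<in>A. \<forall>q\<in>A. q \<le> m \<longrightarrow> q = m"
  proof (rule predicate_Zorn)
    show "partial_order_on A ?R"
      by (rule partial_order_on_relation_ofI) auto
  next
    fix C assume C: "C \<in> Chains ?R"
    then have CA: "C \<subseteq> A" and chain: "\<And>q q'. q \<in> C \<Longrightarrow> q' \<in> C \<Longrightarrow> q \<le> q' \<or> q' \<le> q"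
      unfolding Chains_def relation_of_def by auto
    show "\<exists>u\<in>A. \<forall>q\<in>C. u \<le> q"
    proof (cases "C = {}")
      case True
      with p show ?thesis unfolding A_def by auto
    next
      case False
      define u where "u x = (INF q\<in>C. q x)" for x
      have bdd: "bdd_below ((\<lambda>q. q x) ` C)" for x
      proof (rule bdd_belowI2)
        fix q assume "q \<in> C"
        with CA have "sublinear q" "q (- x) \<le> p (- x)" unfolding A_def by auto
        then show "- p (- x) \<le> q x" using sublinear_minus[of q x] by linarith
      qed
      have upper: "u x \<le> q x" if "q \<in> C" for x q
        unfolding u_def by (rule cINF_lower[OF bdd that])
      have lower: "m \<le> u x" if "\<And>q. q \<in> C \<Longrightarrow> m \<le> q x" for m x
        unfolding u_def by (rule cINF_greatest) (use False that in auto)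
      have "sublinear u"
      proof (rule sublinearI)
        fix x y
        have "u (x + y) - u y \<le> q x" if q: "q \<in> C" for q
        proof -
          have "u (x + y) - q x \<le> q' y" if q': "q' \<in> C" for q'
          proof -
            \<comment> \<open>As \<open>C\<close> is a chain, one member lies below both, which bounds the infimum by a mixed sum.\<close>
            obtain s where s: "s \<in> C" "s \<le> q" "s \<le> q'" using chain[OF q q'] q q' by auto
            have "u (x + y) \<le> s (x + y)" by (rule upper[OF s(1)])
            also have "\<dots> \<le> s x + s y" using s(1) CA by (auto simp: A_def intro: sublinear_add)
            also have "\<dots> \<le> q x + q' y" using s(2,3) by (simp add: le_fun_def add_mono)
            finally show ?thesis by linarith
          qed
          then have "u (x + y) - q x \<le> u y" by (rule lower)
          then show ?thesis by linarith
        qed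
        then have "u (x + y) - u y \<le> u x" by (rule lower)
        then show "u (x + y) \<le> u x + u y" by linarith
      next
        fix r :: real and x :: 'v assume r: "r > 0"
        have "u (r *\<^sub>R x) / r \<le> q x" if q: "q \<in> C" for q
        proof -
          have "sublinear q" using q CA by (auto simp: A_def)
          with upper[OF q, of "r *\<^sub>R x"] r show ?thesis by (simp add: sublinear_scale field_simps)
        qed
        then have "u (r *\<^sub>R x) / r \<le> u x" by (rule lower)
        with r show "u (r *\<^sub>R x) \<le> r * u x" by (simp add: field_simps)
      qed
      moreover have "u x \<le> p x" for x
      proof -
        from False obtain q where "q \<in> C" by blast
        with CA have "q x \<le> p x" unfolding A_def by blast
        with upper[OF \<open>q \<in> C\<close>, of x] show ?thesis by linarith
      qed
      ultimately have "u \<in> A" unfolding A_def by blast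
      with upper show ?thesis by (auto simp: le_fun_def)
    qed
  qed
  then obtain m where m: "sublinear m" "\<And>x. m x \<le> p x" and
    minimal: "\<And>q. sublinear q \<Longrightarrow> (\<And>x. q x \<le> m x) \<Longrightarrow> q = m"
  proof -
    from \<open>\<exists>m\<in>A. \<forall>q\<in>A. q \<le> m \<longrightarrow> q = m\<close> obtain m
      where m: "m \<in> A" "\<And>q. q \<in> A \<Longrightarrow> q \<le> m \<Longrightarrow> q = m" by blast
    then have le: "\<And>x. m x \<le> p x" by (simp add: A_def)
    have "q = m" if "sublinear q" "\<And>x. q x \<le> m x" for q
    proof (rule m(2))
      have "q x \<le> p x" for x using that(2)[of x] le[of x] by linarith
      with that show "q \<in> A" by (simp add: A_def)
    qed (simp add: le_fun_def that)
    with m(1) le that show thesis by (simp add: A_def)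
  qed
  have add: "m (x + a) = m x + m a" for x a
  proof (rule antisym)
    obtain q where q: "sublinear q" "\<And>x. q x \<le> m x" "\<And>x. q x \<le> m (x + a) - m a"
      by (rule sublinear_ray_infimum[OF m(1)]) blast
    then have "q = m" by (intro minimal)
    with q(3)[of x] show "m x + m a \<le> m (x + a)" by simp
  qed (rule sublinear_add[OF m(1)])
  have minus: "m (- x) = - m x" for x
    using add[of x "- x"] sublinear_zero[OF m(1)] by simp
  have "m (r *\<^sub>R x) = r * m x" for r x
  proof (cases "r > 0")
    case False
    show ?thesis
    proof (cases "r = 0")
      case False
      with \<open>\<not> r > 0\<close> have "m ((- r) *\<^sub>R x) = - r * m x" by (intro sublinear_scale[OF m(1)]) simp
      then show ?thesis using minus[of "r *\<^sub>R x"] by simp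
    qed (simp add: sublinear_zero[OF m(1)])
  qed (rule sublinear_scale[OF m(1)])
  with add have "linear m" by (intro linearI) auto
  with m(2) show ?thesis by blast
qed

text \<open>The only complex-linear functional with real part \<open>g\<close> is \<open>x \<mapsto> g x - \<i> * g (\<i> x)\<close>. Rotating \<open>x\<close> makes
  its value real and nonnegative, so the bound on the real part bounds the modulus.\<close>

lemma complexify_bounded_real_functional:
  fixes g :: "'v::complex_normed_vector \<Rightarrow> real"
  assumes g: "linear g" and le: "\<And>x. g x \<le> B * norm x"
  obtains G :: "'v \<Rightarrow> complex" where "clinear G" "\<And>x. Re (G x) = g x" "\<And>x. cmod (G x) \<le> B * norm x"
proof
  interpret g: linear g by (rule g)
  define G where "G x = Complex (g x) (- g (\<i> *\<^sub>C x))" for x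
  show Re: "Re (G x) = g x" for x by (simp add: G_def)
  have decomp: "c *\<^sub>C x = Re c *\<^sub>R x + Im c *\<^sub>R (\<i> *\<^sub>C x)" for c and x :: 'v
  proof -
    have "c = complex_of_real (Re c) + complex_of_real (Im c) * \<i>" by (simp add: complex_eq_iff)
    then have "c *\<^sub>C x = (complex_of_real (Re c) + complex_of_real (Im c) * \<i>) *\<^sub>C x"
      by (rule arg_cong)
    then show ?thesis unfolding scaleC_add_left scaleC_scaleC[symmetric] scaleR_scaleC .
  qed
  have ii: "\<i> *\<^sub>C \<i> *\<^sub>C x = - x" for x :: 'v
    by simp
  have iR: "\<i> *\<^sub>C r *\<^sub>R x = r *\<^sub>R \<i> *\<^sub>C x" for r and x :: 'v
    unfolding scaleR_scaleC scaleC_scaleC by (simp only: mult.commute)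
  show lin: "clinear G"
    unfolding clinear_iff
  proof (intro conjI allI)
    fix x y show "G (x + y) = G x + G y"
      by (simp add: G_def scaleC_add_right g.add complex_eq_iff)
  next
    fix c x show "G (c *\<^sub>C x) = c *\<^sub>C G x"
      unfolding G_def decomp[of c x]
      by (simp add: scaleC_add_right iR ii g.add g.diff g.scale g.neg scaleC_complex_def algebra_simps complex_eq_iff)
  qed
  fix x
  show "cmod (G x) \<le> B * norm x"
  proof (cases "G x = 0")
    case True
    from le[of x] le[of "- x"] have "0 \<le> B * norm x" by (simp add: g.neg)
    with True show ?thesis by simp
  next
    case False
    define c where "c = cnj (G x) / cmod (G x)"
    have c: "cmod c = 1" "c * G x = cmod (G x)"
      using False by (simp_all add: c_def norm_divide complex_norm_square[symmetric] power2_eq_square mult.commute)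
    have "cmod (G x) = Re (G (c *\<^sub>C x))"
      using lin c(2) by (simp add: clinear_iff scaleC_complex_def)
    also have "\<dots> \<le> B * norm (c *\<^sub>C x)" unfolding Re by (rule le)
    finally show ?thesis by (simp add: norm_scaleC c(1))
  qed
qed

lemma sublinear_norm:
  assumes "B \<ge> 0"
  shows "sublinear (\<lambda>x::'v::real_normed_vector. B * norm x)"
proof (rule sublinearI)
  show "B * norm (x + y) \<le> B * norm x + B * norm y" for x y :: 'v
    using mult_left_mono[OF norm_triangle_ineq assms] by (simp add: distrib_left)
qed simp

text \<open>A real-linear functional below the cone infimum for \<open>C = S\<close> and \<open>Re f\<close> is at least \<open>Re f\<close> at
  \<open>x\<close> and at \<open>- x\<close> for \<open>x \<in> S\<close>, hence equal to it on \<open>S\<close>. Since \<open>S\<close> is closed under multiplication by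
  \<open>\<i>\<close>, the complexification then agrees with \<open>f\<close> in its imaginary part as well.\<close>

lemma hahn_banach_norm_extension:
  fixes f :: "'v::complex_normed_vector \<Rightarrow> complex"
  assumes S: "csubspace S" and f: "clinear f" and "B \<ge> 0"
    and bound: "\<And>x. x \<in> S \<Longrightarrow> cmod (f x) \<le> B * norm x"
  obtains g where "clinear g" "\<And>x. x \<in> S \<Longrightarrow> g x = f x" "\<And>x. cmod (g x) \<le> B * norm x"
proof -
  note S_scale = complex_vector.subspace_scale[OF S]
  have f_add: "f (x + y) = f x + f y" and f_scale: "f (c *\<^sub>C x) = c * f x" for c x y
    using f by (auto simp: clinear_iff scaleC_complex_def)
  have f_minus: "f (- x) = - f x" for x
    using f_scale[of "-1" x] by simp
  obtain q where q: "sublinear q" "\<And>x. q x \<le> B * norm x"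
    "\<And>x c. c \<in> S \<Longrightarrow> q x \<le> B * norm (x + c) - Re (f c)"
  proof (rule sublinear_cone_infimum[OF sublinear_norm[OF \<open>B \<ge> 0\<close>], of S "\<lambda>x. Re (f x)"])
    show "Re (f x) \<le> B * norm x" if "x \<in> S" for x
      using bound[OF that] complex_Re_le_cmod[of "f x"] by linarith
    show "r *\<^sub>R x \<in> S" if "x \<in> S" for r x
      unfolding scaleR_scaleC by (rule S_scale[OF that])
    show "Re (f (r *\<^sub>R x)) = r * Re (f x)" for r x
      unfolding scaleR_scaleC by (simp add: f_scale)
    show "Re (f 0) = 0" using f_scale[of 0 0] by simp
  qed (simp_all add: f_add complex_vector.subspace_0[OF S] complex_vector.subspace_add[OF S])
  obtain h where h: "linear h" "\<And>x. h x \<le> q x" using ex_linear_le_sublinear[OF q(1)] by blast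
  then interpret h: linear h by blast
  have ge: "Re (f x) \<le> h x" if "x \<in> S" for x
    using q(3)[OF that, of "- x"] h(2)[of "- x"] by (simp add: h.neg)
  have Re_eq: "h x = Re (f x)" if "x \<in> S" for x
    using ge[OF that] ge[of "- x"] complex_vector.subspace_neg[OF S that] that
    by (simp add: h.neg f_minus)
  have "h x \<le> B * norm x" for x using h(2)[of x] q(2)[of x] by linarith
  then obtain g where g: "clinear g" "\<And>x. Re (g x) = h x" "\<And>x. cmod (g x) \<le> B * norm x"
    using complexify_bounded_real_functional[OF h(1)] by blast
  have "g x = f x" if "x \<in> S" for x
  proof (rule complex_eqI)
    show "Re (g x) = Re (f x)" by (simp add: g(2) Re_eq[OF that])
    have "Re (g (\<i> *\<^sub>C x)) = Re (f (\<i> *\<^sub>C x))" by (simp add: g(2) Re_eq S_scale that)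
    then show "Im (g x) = Im (f x)"
      using g(1) by (simp add: f_scale clinear_iff scaleC_complex_def)
  qed
  with g that show thesis by blast
qed

text \<open>Dominate by the infimum of the norm along the ray through \<open>x\<close>: at \<open>- x\<close> it is at most \<open>- norm x\<close>,
  which forces the real part of the functional at \<open>x\<close> to be at least \<open>norm x\<close>.\<close>

lemma ex_norming_functional:
  fixes x :: "'v::complex_normed_vector"
  obtains u :: "'v \<Rightarrow> complex" where "clinear u" "\<And>y. cmod (u y) \<le> norm y" "cmod (u x) = norm x"
proof -
  have "sublinear (norm :: 'v \<Rightarrow> real)" using sublinear_norm[of 1] by simp
  then obtain q where q: "sublinear q" "\<And>y. q y \<le> norm y" "\<And>y. q y \<le> norm (y + x) - norm x"
    by (rule sublinear_ray_infimum) blast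
  obtain h where h: "linear h" "\<And>y. h y \<le> q y" using ex_linear_le_sublinear[OF q(1)] by blast
  then interpret h: linear h by blast
  have "h y \<le> 1 * norm y" for y using h(2)[of y] q(2)[of y] by simp
  then obtain u where u: "clinear u" "\<And>y. Re (u y) = h y" "\<And>y. cmod (u y) \<le> 1 * norm y"
    using complexify_bounded_real_functional[OF h(1)] by blast
  have "norm x \<le> Re (u x)"
    using h(2)[of "- x"] q(3)[of "- x"] by (simp add: u(2) h.neg)
  also have "\<dots> \<le> cmod (u x)" by (rule complex_Re_le_cmod)
  finally have "cmod (u x) = norm x" using u(3)[of x] by simp
  with u that show thesis by simp
qed

section \<open>The differential at the origin\<close>

definition deriv0 :: "'a::complex_normed_vector hl0 \<Rightarrow> 'a \<Rightarrow> complex"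
  where "deriv0 f = frechet_derivative (hl0_apply f) (at 0)"

lemma hl0_props:
  fixes f :: "'a::complex_normed_vector hl0"
  shows hl0_zero: "hl0_apply f 0 = 0"
    and hl0_holomorphic: "cholomorphic_on (hl0_apply f) (ball 0 1)"
    and hl0_lipschitz: "(norm f)-lipschitz_on (ball 0 1) (hl0_apply f)"
proof -
  have *: "hl0_apply f 0 = 0 \<and> cholomorphic_on (hl0_apply f) (ball 0 1) \<and>
      (\<exists>C. C-lipschitz_on (ball 0 1) (hl0_apply f))"
    using hl0_apply[of f] by auto
  then show "hl0_apply f 0 = 0" "cholomorphic_on (hl0_apply f) (ball 0 1)" by auto
  from * show "(norm f)-lipschitz_on (ball 0 1) (hl0_apply f)"
    unfolding norm_hl0.rep_eq using lipschitz_const_lipschitz_on by blast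
qed

lemma hl0_dist_le:
  fixes f :: "'a::complex_normed_vector hl0"
  assumes "x \<in> ball 0 1" "y \<in> ball 0 1"
  shows "cmod (hl0_apply f x - hl0_apply f y) \<le> norm f * norm (x - y)"
  using lipschitz_onD[OF hl0_lipschitz assms] by (simp add: dist_norm)

lemma deriv0_unique:
  assumes "(hl0_apply f has_derivative D) (at 0)"
  shows "deriv0 f = D"
  unfolding deriv0_def using frechet_derivative_at[OF assms] by simp

lemma deriv0:
  fixes f :: "'a::complex_normed_vector hl0"
  shows deriv0_has_derivative: "(hl0_apply f has_derivative deriv0 f) (at 0)"
    and clinear_deriv0: "clinear (deriv0 f)"
proof -
  obtain D where "clinear D" "(hl0_apply f has_derivative D) (at 0)"
    using hl0_holomorphic[of f] unfolding cholomorphic_on_def by force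
  with deriv0_unique show "(hl0_apply f has_derivative deriv0 f) (at 0)" "clinear (deriv0 f)"
    by metis+
qed

lemma deriv0_add_arg: "deriv0 f (x + y) = deriv0 f x + deriv0 f y"
  and deriv0_scale_arg: "deriv0 f (c *\<^sub>C x) = c * deriv0 f x"
  using clinear_deriv0[of f] by (auto simp: clinear_iff scaleC_complex_def)

lemma deriv0_add: "deriv0 (f + g) x = deriv0 f x + deriv0 g x"
proof -
  have "deriv0 (f + g) = (\<lambda>x. deriv0 f x + deriv0 g x)"
    by (rule deriv0_unique)
      (auto simp: plus_hl0.rep_eq[abs_def] intro!: has_derivative_add deriv0_has_derivative)
  then show ?thesis by simp
qed

lemma deriv0_scale: "deriv0 (c *\<^sub>C f) x = c * deriv0 f x"
proof -
  have "deriv0 (c *\<^sub>C f) = (\<lambda>x. c *\<^sub>C deriv0 f x)"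
    by (rule deriv0_unique)
      (auto simp: scaleC_hl0.rep_eq[abs_def]
        intro!: bounded_linear.has_derivative[OF bounded_linear_scaleC] deriv0_has_derivative)
  then show ?thesis by (simp add: scaleC_complex_def)
qed

lemma hl0_apply_diff: "hl0_apply (f - g) x = hl0_apply f x - hl0_apply g x"
  unfolding minus_hl0_def uminus_hl0_def plus_hl0.rep_eq scaleC_hl0.rep_eq scaleC_complex_def
  by simp

lemma deriv0_diff: "deriv0 (f - g) x = deriv0 f x - deriv0 g x"
  unfolding minus_hl0_def uminus_hl0_def deriv0_add deriv0_scale by simp

lemma bounded_linear_scaleC_left: "bounded_linear (\<lambda>z. z *\<^sub>C (x :: 'a::complex_normed_vector))"
  by (rule bounded_linear_intro[where K = "norm x"])
    (simp_all add: scaleC_add_left norm_scaleC scaleR_scaleC[where 'a = 'a] scaleC_scaleC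
      scaleR_conv_of_real)

text \<open>This is Cauchy's estimate for the one-variable function \<open>z \<mapsto> f (z x)\<close>, whose derivative at \<open>0\<close> is
  \<open>df(0)(x)\<close>. It bounds the differential by values of \<open>f\<close> on a compact subset of the ball, which is
  what continuity for the compact-open topology requires.\<close>

lemma deriv0_cauchy_bound:
  fixes f :: "'a::complex_normed_vector hl0"
  assumes r: "r > 0" "r * norm x < 1"
    and B: "\<And>z. cmod z = r \<Longrightarrow> cmod (hl0_apply f (z *\<^sub>C x)) \<le> B"
  shows "cmod (deriv0 f x) \<le> B / r"
proof -
  define h where "h z = hl0_apply f (z *\<^sub>C x)" for z
  have line: "((\<lambda>z. z *\<^sub>C x) has_derivative (\<lambda>z. z *\<^sub>C x)) (at z)" for z
    by (rule bounded_linear_imp_has_derivative[OF bounded_linear_scaleC_left])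
  have deriv: "(h has_field_derivative D x) (at z)"
    if D: "clinear D" "(hl0_apply f has_derivative D) (at (z *\<^sub>C x))" for z D
  proof -
    have "(h has_derivative (\<lambda>w. D (w *\<^sub>C x))) (at z)"
      unfolding h_def using has_derivative_compose[OF line D(2)] .
    moreover have "(\<lambda>w. D (w *\<^sub>C x)) = (*) (D x)"
      using D(1) by (auto simp: clinear_iff scaleC_complex_def mult.commute)
    ultimately show ?thesis by (simp add: has_field_derivative_def)
  qed
  have hol: "h field_differentiable (at z)" if "cmod z \<le> r" for z
  proof -
    have "norm (z *\<^sub>C x) \<le> r * norm x" using that by (simp add: norm_scaleC mult_right_mono)
    with r have "z *\<^sub>C x \<in> ball 0 1" by simp
    then obtain D where "clinear D" "(hl0_apply f has_derivative D) (at (z *\<^sub>C x))"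
      using hl0_holomorphic[of f] unfolding cholomorphic_on_def by blast
    from deriv[OF this] show ?thesis by (auto simp: field_differentiable_def)
  qed
  have "cmod ((deriv ^^ 1) h 0) \<le> fact 1 * B / r ^ 1"
  proof (rule Cauchy_inequality)
    show "h holomorphic_on ball 0 r"
      unfolding holomorphic_on_def
      by (rule ballI, rule field_differentiable_at_within, rule hol) simp
    show "continuous_on (cball 0 r) h"
      by (intro continuous_at_imp_continuous_on ballI field_differentiable_imp_continuous_at hol) simp
  qed (use r B in \<open>auto simp: h_def\<close>)
  moreover have "(h has_field_derivative deriv0 f x) (at 0)"
    by (rule deriv) (simp_all add: clinear_deriv0 deriv0_has_derivative)
  then have "deriv h 0 = deriv0 f x" by (rule DERIV_imp_deriv)
  ultimately show ?thesis by simp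
qed

lemma ex_small_radius: "\<exists>r>0. r * norm (x :: 'a::real_normed_vector) < 1"
proof (intro exI conjI)
  have pos: "norm x + 1 > 0" using norm_ge_zero[of x] by linarith
  then show "1 / (norm x + 1) > 0" by simp
  show "1 / (norm x + 1) * norm x < 1" using pos by (simp add: divide_less_eq)
qed

lemma deriv0_bound:
  fixes f :: "'a::complex_normed_vector hl0"
  shows "cmod (deriv0 f x) \<le> norm f * norm x"
proof -
  obtain r where r: "r > 0" "r * norm x < 1" using ex_small_radius by blast
  have "cmod (deriv0 f x) \<le> (norm f * (r * norm x)) / r"
  proof (rule deriv0_cauchy_bound[OF r])
    fix z assume "cmod z = r"
    with r hl0_dist_le[of "z *\<^sub>C x" 0 f]
    show "cmod (hl0_apply f (z *\<^sub>C x)) \<le> norm f * (r * norm x)"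
      by (simp add: norm_scaleC hl0_zero)
  qed
  with r show ?thesis by simp
qed

lemma topspace_hl0_tau0: "topspace (hl0_tau0 :: 'a::complex_normed_vector hl0 topology) = UNIV"
proof -
  have "openin hl0_tau0 (UNIV :: 'a hl0 set)"
    unfolding openin_hl0_tau0
    by (rule ballI, rule exI[of _ "{}"], rule exI[of _ 1]) simp
  from openin_subset[OF this] show ?thesis by (rule top.extremum_uniqueI)
qed

lemma bounded_linear_deriv0: "bounded_linear (\<lambda>f :: 'a::complex_normed_vector hl0. deriv0 f x)"
  by (rule bounded_linear_intro[where K = "norm x"])
    (simp_all add: deriv0_add scaleR_hl0_def deriv0_scale deriv0_bound scaleR_conv_of_real)

text \<open>A neighbourhood of \<open>f\<close> is given by the compact disc of radius \<open>r\<close> in the complex line through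
  \<open>x\<close>: if \<open>g\<close> is within \<open>d * r / 2\<close> of \<open>f\<close> there, the differentials at \<open>x\<close> differ by at most
  \<open>d / 2\<close>.\<close>

lemma continuous_map_deriv0:
  fixes x :: "'a::complex_normed_vector"
  shows "continuous_map hl0_tau0 euclidean (\<lambda>f. deriv0 f x)"
  unfolding continuous_map_def
proof (intro conjI allI impI)
  fix U :: "complex set" assume "openin euclidean U"
  then have U: "open U" by simp
  obtain r where r: "r > 0" "r * norm x < 1" using ex_small_radius by blast
  let ?K = "(\<lambda>z. z *\<^sub>C x) ` cball 0 r"
  show "openin hl0_tau0 {f \<in> topspace hl0_tau0. deriv0 f x \<in> U}"
    unfolding openin_hl0_tau0 topspace_hl0_tau0
  proof
    fix f assume "f \<in> {f \<in> UNIV. deriv0 f x \<in> U}"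
    with U obtain d where d: "d > 0" "ball (deriv0 f x) d \<subseteq> U"
      unfolding open_contains_ball by blast
    have K: "compact ?K"
      by (intro compact_continuous_image linear_continuous_on bounded_linear_scaleC_left) simp
    have K_ball: "?K \<subseteq> ball 0 1"
    proof (rule image_subsetI)
      fix z :: complex assume "z \<in> cball 0 r"
      then have "cmod z * norm x \<le> r * norm x" by (simp add: mult_right_mono)
      with r show "z *\<^sub>C x \<in> ball 0 1" by (simp add: norm_scaleC)
    qed
    have pos: "d * r / 2 > 0" using d r by simp
    have nbhd: "g \<in> {f \<in> UNIV. deriv0 f x \<in> U}"
      if g: "\<forall>y\<in>?K. dist (hl0_apply g y) (hl0_apply f y) < d * r / 2" for g
    proof -
      have "cmod (deriv0 (g - f) x) \<le> (d * r / 2) / r"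
      proof (rule deriv0_cauchy_bound[OF r])
        fix z assume "cmod z = r"
        then have "z *\<^sub>C x \<in> ?K" by (intro imageI) simp
        from bspec[OF g this]
        have "dist (hl0_apply g (z *\<^sub>C x)) (hl0_apply f (z *\<^sub>C x)) < d * r / 2" .
        then show "cmod (hl0_apply (g - f) (z *\<^sub>C x)) \<le> d * r / 2"
          by (simp add: hl0_apply_diff dist_norm)
      qed
      also have "\<dots> < d" using d r by simp
      finally have "deriv0 g x \<in> ball (deriv0 f x) d"
        by (simp add: deriv0_diff dist_norm norm_minus_commute)
      with d(2) show ?thesis by auto
    qed
    show "\<exists>K e. compact K \<and> K \<subseteq> ball 0 1 \<and> e > 0 \<and>
        {g. \<forall>x\<in>K. dist (hl0_apply g x) (hl0_apply f x) < e} \<subseteq> {f \<in> UNIV. deriv0 f x \<in> U}"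
      by (intro exI[of _ ?K] exI[of _ "d * r / 2"] conjI K K_ball pos subsetI nbhd)
        (rule CollectD)
  qed
qed simp

section \<open>Differentiation in a fixed direction as an element of the predual\<close>

lift_definition eval_deriv0 :: "'a::complex_normed_vector \<Rightarrow> 'a g0"
  is "\<lambda>x. Blinfun (\<lambda>f. deriv0 f x)"
proof -
  fix x :: 'a
  have eq: "blinfun_apply (Blinfun (\<lambda>f. deriv0 f x)) = (\<lambda>f. deriv0 f x)"
    by (rule bounded_linear_Blinfun_apply[OF bounded_linear_deriv0])
  show "clinear (blinfun_apply (Blinfun (\<lambda>f. deriv0 f x))) \<and>
    continuous_map (subtopology hl0_tau0 {f. norm f \<le> 1}) euclidean
      (blinfun_apply (Blinfun (\<lambda>f. deriv0 f x)))"
    unfolding eq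
  proof
    show "clinear (\<lambda>f. deriv0 f x)"
      by (simp add: clinear_iff deriv0_add deriv0_scale scaleC_complex_def)
  qed (rule continuous_map_from_subtopology[OF continuous_map_deriv0])
qed

abbreviation g0_apply :: "'a::complex_normed_vector g0 \<Rightarrow> 'a hl0 \<Rightarrow> complex"
  where "g0_apply \<phi> \<equiv> blinfun_apply (blinfun_of_g0 \<phi>)"

lemma g0_apply_eval_deriv0: "g0_apply (eval_deriv0 x) f = deriv0 f x"
  by (simp add: eval_deriv0.rep_eq bounded_linear_Blinfun_apply bounded_linear_deriv0)

lemma g0_eqI:
  assumes "\<And>f. g0_apply \<phi> f = g0_apply \<psi> f"
  shows "\<phi> = \<psi>"
  using assms by (simp add: blinfun_of_g0_inject[symmetric] blinfun_eqI)

lemma g0_apply_le: "cmod (g0_apply \<phi> f) \<le> norm \<phi> * norm f"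
  unfolding norm_g0.rep_eq by (rule norm_blinfun)

lemma clinear_g0_apply: "clinear (g0_apply \<phi>)"
  using blinfun_of_g0[of \<phi>] by blast

lemma clinear_eval_deriv0: "clinear eval_deriv0"
  unfolding clinear_iff
  by (intro conjI allI g0_eqI) (simp_all add: g0_apply_eval_deriv0 plus_g0.rep_eq scaleC_g0.rep_eq
      plus_blinfun.rep_eq scaleC_blinfun.rep_eq deriv0_add_arg deriv0_scale_arg scaleC_complex_def)

lemma norm_eval_deriv0_le: "norm (eval_deriv0 x) \<le> norm x"
  unfolding norm_g0.rep_eq
  by (rule norm_blinfun_bound) (simp_all add: g0_apply_eval_deriv0 deriv0_bound mult.commute[of "norm x"])

section \<open>Linear functions in the unit ball\<close>

text \<open>This is the dual of the underlying space, embedded by restriction to the ball. A function that is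
  linear on the ball is there its own differential at \<open>0\<close>, so the linear function need not be
  chosen, and \<open>deriv0\<close> recovers it on the whole space.\<close>

definition linear_hl0 :: "'a::complex_normed_vector hl0 set"
  where "linear_hl0 = {f. \<forall>x\<in>ball 0 1. hl0_apply f x = deriv0 f x}"

lemma ex_linear_hl0:
  fixes u :: "'a::complex_normed_vector \<Rightarrow> complex"
  assumes u: "clinear u" and bound: "\<And>x. cmod (u x) \<le> norm x"
  obtains f where "f \<in> linear_hl0" "norm f \<le> 1" "deriv0 f = u"
proof -
  have lin: "u (x + y) = u x + u y" "u (c *\<^sub>C x) = c * u x" for x y c
    using u by (auto simp: clinear_iff scaleC_complex_def)
  have bl: "bounded_linear u"
    by (rule bounded_linear_intro[where K = 1])
      (use bound lin in \<open>simp_all add: scaleR_scaleC scaleC_complex_def\<close>)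
  interpret u: bounded_linear u by (rule bl)
  define v where "v x = (if x \<in> ball 0 1 then u x else 0)" for x
  have v_deriv: "(v has_derivative u) (at x)" if "x \<in> ball 0 1" for x
    by (rule has_derivative_transform_within_open[OF bounded_linear_imp_has_derivative[OF bl] open_ball that])
      (simp add: v_def)
  have v_lip: "1-lipschitz_on (ball 0 1) v"
    by (rule lipschitz_onI) (use bound in \<open>simp_all add: v_def dist_norm u.diff[symmetric]\<close>)
  have "v \<in> {f. (\<forall>x. x \<notin> ball 0 1 \<longrightarrow> f x = 0) \<and> f 0 = 0 \<and>
      cholomorphic_on f (ball 0 1) \<and> (\<exists>C. C-lipschitz_on (ball 0 1) f)}"
    using v_deriv v_lip u by (auto simp: cholomorphic_on_def v_def[of 0] u.zero) (auto simp: v_def)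
  then have app: "hl0_apply (Abs_hl0 v) = v" by (rule Abs_hl0_inverse)
  have d: "deriv0 (Abs_hl0 v) = u"
    by (rule deriv0_unique) (simp add: app v_deriv)
  show thesis
  proof
    show "Abs_hl0 v \<in> linear_hl0" by (simp add: linear_hl0_def app d v_def)
    show "norm (Abs_hl0 v) \<le> 1"
      unfolding norm_hl0.rep_eq app by (rule lipschitz_const_le[OF v_lip])
  qed (rule d)
qed

lemma ex_norming_hl0:
  fixes x :: "'a::complex_normed_vector"
  obtains f where "f \<in> linear_hl0" "norm f \<le> 1" "cmod (deriv0 f x) = norm x"
  using ex_norming_functional[of x] ex_linear_hl0 by metis

section \<open>Restricting the predual to linear functions\<close>

lemma complex_functional:
  fixes h :: "'v::complex_vector \<Rightarrow> complex"
  assumes "clinear h"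
  shows "h (v + w) = h v + h w" "h (c *\<^sub>C v) = c * h v" "h (v - w) = h v - h w" "h 0 = 0"
proof -
  interpret Vector_Spaces.linear scaleC scaleC h by (rule assms)
  show "h (v + w) = h v + h w" "h (c *\<^sub>C v) = c * h v" "h (v - w) = h v - h w" "h 0 = 0"
    by (simp_all add: add scale diff zero scaleC_complex_def)
qed

text \<open>By induction on \<open>F\<close>: restricted to the kernel of \<open>l j\<close> the functional is a combination of the
  others; the difference is then a multiple of \<open>l j\<close>, with the factor read off at any vector at
  which \<open>l j\<close> does not vanish. The subspace \<open>L\<close> is there to carry the kernel through the induction.\<close>

lemma functional_in_span:
  fixes g :: "'v::complex_vector \<Rightarrow> complex" and l :: "'i \<Rightarrow> 'v \<Rightarrow> complex"
  assumes "finite F" "csubspace L" "clinear g" "\<And>i. i \<in> F \<Longrightarrow> clinear (l i)"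
    and "\<And>v. v \<in> L \<Longrightarrow> (\<And>i. i \<in> F \<Longrightarrow> l i v = 0) \<Longrightarrow> g v = 0"
  shows "\<exists>c. \<forall>v\<in>L. g v = (\<Sum>i\<in>F. c i * l i v)"
  using assms
proof (induction F arbitrary: L rule: finite_induct)
  case empty
  then show ?case by simp
next
  case (insert j F)
  note L = complex_vector.subspace_add[OF insert.prems(1)]
    complex_vector.subspace_scale[OF insert.prems(1)]
    complex_vector.subspace_diff[OF insert.prems(1)]
    complex_vector.subspace_0[OF insert.prems(1)]
  note g = complex_functional[OF insert.prems(2)]
  have l: "clinear (l i)" if "i \<in> insert j F" for i using insert.prems(3) that .
  note lj = complex_functional[OF l[OF insertI1]]
  note li = complex_functional[OF l[OF insertI2]]
  let ?L = "{v \<in> L. l j v = 0}"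
  have "csubspace ?L"
    unfolding complex_vector.subspace_def by (auto simp: L lj)
  then have "\<exists>c. \<forall>v\<in>?L. g v = (\<Sum>i\<in>F. c i * l i v)"
    by (rule insert.IH) (use insert.prems in auto)
  then obtain c where c: "\<And>v. v \<in> L \<Longrightarrow> l j v = 0 \<Longrightarrow> g v = (\<Sum>i\<in>F. c i * l i v)" by blast
  show ?case
  proof (cases "\<forall>v\<in>L. l j v = 0")
    case True
    with c insert.hyps show ?thesis by (intro exI[of _ c]) simp
  next
    case False
    then obtain w where w: "w \<in> L" "l j w \<noteq> 0" by blast
    define g' where "g' v = g v - (\<Sum>i\<in>F. c i * l i v)" for v
    define b where "b = g' w / l j w"
    have "g v = b * l j v + (\<Sum>i\<in>F. c i * l i v)" if v: "v \<in> L" for v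
    proof -
      let ?a = "l j v / l j w"
      have "v - ?a *\<^sub>C w \<in> L" by (rule L(3)[OF v L(2)[OF w(1)]])
      moreover have "l j (v - ?a *\<^sub>C w) = 0" using w(2) by (simp add: lj)
      ultimately have "g' (v - ?a *\<^sub>C w) = 0" by (simp add: g'_def c)
      moreover have "g' (v - ?a *\<^sub>C w) = g' v - ?a * g' w"
      proof -
        have "(\<Sum>i\<in>F. c i * l i (v - ?a *\<^sub>C w)) = (\<Sum>i\<in>F. c i * l i v - ?a * (c i * l i w))"
          by (rule sum.cong[OF refl]) (simp add: li right_diff_distrib)
        also have "\<dots> = (\<Sum>i\<in>F. c i * l i v) - ?a * (\<Sum>i\<in>F. c i * l i w)"
          by (simp only: sum_subtractf sum_distrib_left)
        finally show ?thesis by (simp add: g'_def g right_diff_distrib)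
      qed
      ultimately have "g' v = b * l j v" by (simp add: b_def mult.commute)
      then show ?thesis by (simp add: g'_def diff_eq_eq)
    qed
    moreover have "(\<Sum>i\<in>F. (c(j := b)) i * l i v) = (\<Sum>i\<in>F. c i * l i v)" for v
      by (rule sum.cong) (use insert.hyps in auto)
    ultimately show ?thesis
      using insert.hyps by (intro exI[of _ "c(j := b)"]) simp
  qed
qed

text \<open>Continuity at \<open>0\<close> yields a compact \<open>K\<close> and \<open>d > 0\<close> such that \<open>\<bar>\<phi> f\<bar> < e\<close> for every \<open>f\<close> in the unit
  ball with \<open>\<bar>f\<bar> < d\<close> on \<open>K\<close>. Take a finite \<open>d\<close>-net \<open>F\<close> of \<open>K\<close>: an \<open>f\<close> with Lipschitz constant at
  most \<open>1\<close> that vanishes on \<open>F\<close> is smaller than \<open>d\<close> on \<open>K\<close>. The general case follows by scaling.\<close>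

lemma g0_small_on_annihilator:
  fixes \<phi> :: "'a::complex_normed_vector g0"
  assumes "e > 0"
  obtains F where "finite F" "F \<subseteq> ball 0 1"
    "\<And>f. (\<And>x. x \<in> F \<Longrightarrow> hl0_apply f x = 0) \<Longrightarrow> cmod (g0_apply \<phi> f) \<le> e * norm f"
proof -
  let ?X = "subtopology hl0_tau0 {f :: 'a hl0. norm f \<le> 1}"
  have lin: "g0_apply \<phi> (c *\<^sub>C f) = c * g0_apply \<phi> f" "g0_apply \<phi> 0 = 0" for c f
    using clinear_g0_apply[of \<phi>] by (auto simp: clinear_iff scaleC_complex_def)
  have "continuous_map ?X euclidean (g0_apply \<phi>)" using blinfun_of_g0[of \<phi>] by blast
  then have "openin ?X {f \<in> topspace ?X. g0_apply \<phi> f \<in> ball 0 e}"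
    by (rule openin_continuous_map_preimage) simp
  then obtain U where U: "openin hl0_tau0 U"
    "{f \<in> topspace ?X. g0_apply \<phi> f \<in> ball 0 e} = U \<inter> {f. norm f \<le> 1}"
    unfolding openin_subtopology by blast
  have "0 \<in> {f \<in> topspace ?X. g0_apply \<phi> f \<in> ball 0 e}"
    using \<open>e > 0\<close> lin(2) by (simp add: topspace_hl0_tau0)
  then have "0 \<in> U" unfolding U(2) by (rule IntD1)
  with U(1) have "\<exists>K d. compact K \<and> K \<subseteq> ball 0 1 \<and> d > 0 \<and>
      {g. \<forall>x\<in>K. dist (hl0_apply g x) (hl0_apply 0 x) < d} \<subseteq> U"
    unfolding openin_hl0_tau0 by (rule bspec)
  then obtain K d where K: "compact K" "K \<subseteq> ball 0 1" "d > 0"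
    "{g. \<forall>x\<in>K. dist (hl0_apply g x) (hl0_apply 0 x) < d} \<subseteq> U"
    by (elim exE conjE)
  have small: "cmod (g0_apply \<phi> f) < e"
    if "norm f \<le> 1" "\<And>x. x \<in> K \<Longrightarrow> cmod (hl0_apply f x) < d" for f
  proof -
    have "f \<in> U" by (rule subsetD[OF K(4)]) (simp add: zero_hl0.rep_eq that(2))
    with that(1) have "f \<in> {f \<in> topspace ?X. g0_apply \<phi> f \<in> ball 0 e}"
      unfolding U(2) by simp
    then show ?thesis by simp
  qed
  obtain F where F: "finite F" "F \<subseteq> K" "K \<subseteq> (\<Union>x\<in>F. ball x d)"
    using compactE_image[OF K(1), of K "\<lambda>x. ball x d"] K(3) by (metis UN_I centre_in_ball open_ball subsetI)
  show thesis
  proof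
    show "finite F" "F \<subseteq> ball 0 1" using F K by auto
    fix f assume f: "\<And>x. x \<in> F \<Longrightarrow> hl0_apply f x = 0"
    show "cmod (g0_apply \<phi> f) \<le> e * norm f"
    proof (cases "f = 0")
      case False
      define f1 where "f1 = complex_of_real (inverse (norm f)) *\<^sub>C f"
      have f1: "norm f1 = 1" using False by (simp add: f1_def norm_scaleC norm_inverse)
      have "cmod (hl0_apply f1 x) < d" if "x \<in> K" for x
      proof -
        from that F(3) have "x \<in> (\<Union>x\<in>F. ball x d)" by blast
        then obtain y where y: "y \<in> F" "dist y x < d" by auto
        have "x \<in> ball 0 1" "y \<in> ball 0 1" using that y F(2) K(2) by auto
        from hl0_dist_le[OF this, of f1] have "cmod (hl0_apply f1 x - hl0_apply f1 y) \<le> norm (x - y)"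
          by (simp add: f1)
        moreover have "hl0_apply f1 y = 0"
          by (simp add: f1_def scaleC_hl0.rep_eq f[OF y(1)] scaleC_complex_def)
        ultimately show ?thesis using y(2) by (simp add: dist_norm norm_minus_commute)
      qed
      with f1 have "cmod (g0_apply \<phi> f1) < e" by (intro small) auto
      moreover have "cmod (g0_apply \<phi> f1) = inverse (norm f) * cmod (g0_apply \<phi> f)"
        unfolding f1_def lin(1) norm_mult norm_of_real by simp
      ultimately show ?thesis using False by (simp add: field_simps)
    qed (simp add: lin)
  qed
qed

text \<open>The approximating vector is \<open>\<Sum>x\<in>F. c x *\<^sub>C x\<close>, where \<open>c\<close> holds the coefficients of \<open>\<phi> - \<psi>\<close> as a
  combination of evaluations, and \<open>\<psi>\<close> is a Hahn-Banach extension of the restriction of \<open>\<phi>\<close> to the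
  annihilator of \<open>F\<close>. The error on linear functions is exactly \<open>\<psi>\<close>.\<close>

lemma g0_approx_deriv0:
  fixes \<phi> :: "'a::complex_normed_vector g0"
  assumes "e > 0"
  shows "\<exists>y. \<forall>f\<in>linear_hl0. cmod (g0_apply \<phi> f - deriv0 f y) \<le> e * norm f"
proof -
  obtain F where F: "finite F" "F \<subseteq> ball 0 1"
    "\<And>f. (\<And>x. x \<in> F \<Longrightarrow> hl0_apply f x = 0) \<Longrightarrow> cmod (g0_apply \<phi> f) \<le> e * norm f"
    by (rule g0_small_on_annihilator[OF assms]) blast
  define S where "S = {f :: 'a hl0. \<forall>x\<in>F. hl0_apply f x = 0}"
  have S: "csubspace S"
    unfolding complex_vector.subspace_def S_def
    by (auto simp: plus_hl0.rep_eq scaleC_hl0.rep_eq zero_hl0.rep_eq)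
  obtain \<psi> where \<psi>: "clinear \<psi>" "\<And>f. f \<in> S \<Longrightarrow> \<psi> f = g0_apply \<phi> f"
    "\<And>f. cmod (\<psi> f) \<le> e * norm f"
    by (rule hahn_banach_norm_extension[OF S clinear_g0_apply[of \<phi>], of e])
      (use F(3) assms in \<open>auto simp: S_def\<close>)
  have "clinear (\<lambda>f. g0_apply \<phi> f - \<psi> f)"
    using clinear_g0_apply[of \<phi>] \<psi>(1) by (auto simp: clinear_iff scaleC_complex_def algebra_simps)
  moreover have "clinear (\<lambda>f. hl0_apply f x)" for x :: 'a
    by (auto simp: clinear_iff plus_hl0.rep_eq scaleC_hl0.rep_eq)
  ultimately have "\<exists>c. \<forall>f\<in>UNIV. g0_apply \<phi> f - \<psi> f = (\<Sum>x\<in>F. c x * hl0_apply f x)"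
    using F(1) \<psi>(2) by (intro functional_in_span) (auto simp: S_def)
  then obtain c where c: "\<And>f. g0_apply \<phi> f - \<psi> f = (\<Sum>x\<in>F. c x * hl0_apply f x)" by blast
  have "g0_apply \<phi> f - deriv0 f (\<Sum>x\<in>F. c x *\<^sub>C x) = \<psi> f" if f: "f \<in> linear_hl0" for f
  proof -
    interpret Vector_Spaces.linear scaleC scaleC "deriv0 f" by (rule clinear_deriv0)
    have "deriv0 f (\<Sum>x\<in>F. c x *\<^sub>C x) = (\<Sum>x\<in>F. c x * deriv0 f x)"
      by (simp add: sum scale scaleC_complex_def)
    also have "\<dots> = (\<Sum>x\<in>F. c x * hl0_apply f x)"
      by (rule sum.cong) (use f F(2) in \<open>auto simp: linear_hl0_def\<close>)
    finally show ?thesis using c[of f] by (simp add: algebra_simps)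
  qed
  with \<psi>(3) show ?thesis by metis
qed

text \<open>Vectors that approximate the same \<open>\<phi>\<close> are close to each other in norm, because their difference is
  detected by a linear function of norm at most \<open>1\<close>. Completeness provides the limit.\<close>

lemma g0_represented_on_linear_hl0:
  fixes \<phi> :: "'a::complex_banach g0"
  shows "\<exists>y. \<forall>f\<in>linear_hl0. g0_apply \<phi> f = deriv0 f y"
proof -
  have "\<exists>y. \<forall>f\<in>linear_hl0. cmod (g0_apply \<phi> f - deriv0 f y) \<le> inverse (real (Suc n)) * norm f" for n
    by (rule g0_approx_deriv0) simp
  then obtain y where y: "\<And>n f. f \<in> linear_hl0 \<Longrightarrow>
      cmod (g0_apply \<phi> f - deriv0 f (y n)) \<le> inverse (real (Suc n)) * norm f" by metis
  have deriv_diff: "deriv0 f (a - b) = deriv0 f a - deriv0 f b" for f :: "'a hl0" and a b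
    using deriv0_add_arg[of f "a - b" b] by simp
  have diff: "norm (y m - y n) \<le> inverse (real (Suc m)) + inverse (real (Suc n))" for m n
  proof -
    obtain f where f: "f \<in> linear_hl0" "norm f \<le> 1" "cmod (deriv0 f (y m - y n)) = norm (y m - y n)"
      by (rule ex_norming_hl0)
    have "norm (y m - y n) = cmod ((g0_apply \<phi> f - deriv0 f (y n)) - (g0_apply \<phi> f - deriv0 f (y m)))"
      by (simp add: f(3)[symmetric] deriv_diff)
    also have "\<dots> \<le> inverse (real (Suc n)) * norm f + inverse (real (Suc m)) * norm f"
      using norm_triangle_ineq4 y[OF f(1)] by (meson add_mono order_trans)
    also have "\<dots> \<le> inverse (real (Suc n)) * 1 + inverse (real (Suc m)) * 1"
      using f(2) by (intro add_mono mult_left_mono) auto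
    finally show ?thesis by simp
  qed
  have "Cauchy y"
  proof (rule CauchyI)
    fix e :: real assume "e > 0"
    then obtain N where N: "inverse (real (Suc N)) < e / 2" using reals_Archimedean[of "e / 2"] by auto
    have small: "inverse (real (Suc n)) < e / 2" if "n \<ge> N" for n
    proof -
      have "inverse (real (Suc n)) \<le> inverse (real (Suc N))"
        using that by (intro le_imp_inverse_le) simp_all
      with N show ?thesis by linarith
    qed
    show "\<exists>M. \<forall>m\<ge>M. \<forall>n\<ge>M. norm (y m - y n) < e"
    proof (intro exI allI impI)
      fix m n assume "m \<ge> N" "n \<ge> N"
      with diff[of m n] small[of m] small[of n] show "norm (y m - y n) < e" by linarith
    qed
  qed
  then obtain l where l: "y \<longlonglongrightarrow> l" using Cauchy_convergent convergent_def by blast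
  have "g0_apply \<phi> f = deriv0 f l" if f: "f \<in> linear_hl0" for f
  proof (rule LIMSEQ_unique)
    have "bounded_linear (deriv0 f)" using deriv0_has_derivative by (rule has_derivative_bounded_linear)
    then show "(\<lambda>n. deriv0 f (y n)) \<longlonglongrightarrow> deriv0 f l" using l by (rule bounded_linear.tendsto)
    have "(\<lambda>n. inverse (real (Suc n)) * norm f) \<longlonglongrightarrow> 0"
      using tendsto_mult_left_zero[OF LIMSEQ_inverse_real_of_nat] by simp
    then have "(\<lambda>n. g0_apply \<phi> f - deriv0 f (y n)) \<longlonglongrightarrow> 0"
      by (rule Lim_null_comparison[rotated]) (use y[OF f] in simp)
    from tendsto_diff[OF tendsto_const[of "g0_apply \<phi> f"] this]
    show "(\<lambda>n. deriv0 f (y n)) \<longlonglongrightarrow> g0_apply \<phi> f" by simp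
  qed
  then show ?thesis by blast
qed

section \<open>The complemented copy\<close>

theorem proposition2p6:
  shows "\<exists>M :: 'a::complex_banach g0 set.
    csubspace M \<and> one_complemented M \<and> isometric_to TYPE('a) M"
proof -
  let ?J = "eval_deriv0 :: 'a \<Rightarrow> 'a g0"
  obtain T :: "'a g0 \<Rightarrow> 'a" where T: "\<And>\<phi> f. f \<in> linear_hl0 \<Longrightarrow> g0_apply \<phi> f = deriv0 f (T \<phi>)"
    using g0_represented_on_linear_hl0 by metis
  have separate: "a = b" if "\<And>f. f \<in> linear_hl0 \<Longrightarrow> deriv0 f a = deriv0 f b" for a b :: 'a
  proof -
    obtain f where f: "f \<in> linear_hl0" "cmod (deriv0 f (a - b)) = norm (a - b)"
      by (rule ex_norming_hl0)
    with that[OF f(1)] deriv0_add_arg[of f "a - b" b] show ?thesis by simp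
  qed
  have J_lin: "clinear ?J" by (rule clinear_eval_deriv0)
  have TJ: "T (?J x) = x" for x
    by (rule separate) (simp add: T[symmetric] g0_apply_eval_deriv0)
  have T_lin: "clinear T"
    unfolding clinear_iff
    by (auto intro!: separate simp: T[symmetric] deriv0_add_arg deriv0_scale_arg plus_g0.rep_eq
        scaleC_g0.rep_eq plus_blinfun.rep_eq scaleC_blinfun.rep_eq scaleC_complex_def)
  have T_norm: "norm (T \<phi>) \<le> norm \<phi>" for \<phi>
  proof -
    obtain f where f: "f \<in> linear_hl0" "norm f \<le> 1" "cmod (deriv0 f (T \<phi>)) = norm (T \<phi>)"
      by (rule ex_norming_hl0)
    have "norm (T \<phi>) \<le> norm \<phi> * norm f" using g0_apply_le[of \<phi> f] by (simp add: T f)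
    also have "\<dots> \<le> norm \<phi>" using f(2) by (simp add: mult_left_le)
    finally show ?thesis .
  qed
  have J_norm: "norm (?J x) = norm x" for x
    using T_norm[of "?J x"] norm_eval_deriv0_le[of x] by (simp add: TJ)
  have "isometric_to TYPE('a) (range ?J)"
    unfolding isometric_to_def using J_lin J_norm by blast
  moreover have "one_complemented (range ?J)"
    unfolding one_complemented_def
  proof (intro exI[of _ "\<lambda>\<phi>. ?J (T \<phi>)"] conjI allI)
    show "clinear (\<lambda>\<phi>. ?J (T \<phi>))" using T_lin J_lin by (simp add: clinear_iff)
    have "?J x \<in> range (\<lambda>\<phi>. ?J (T \<phi>))" for x by (rule range_eqI[of _ _ "?J x"]) (simp add: TJ)
    then show "range (\<lambda>\<phi>. ?J (T \<phi>)) = range ?J" by auto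
  qed (simp_all add: TJ J_norm T_norm)
  moreover have "csubspace (range ?J)"
  proof -
    \<comment> \<open>The range is the set of fixed points of the linear map \<open>?J \<circ> T\<close>.\<close>
    have "range ?J = {\<phi>. ?J (T \<phi>) = \<phi>}" using TJ by (auto simp: image_iff intro: sym)
    moreover have "?J 0 = 0" "T 0 = 0"
      using J_norm[of 0] T_norm[of 0] by auto
    ultimately show ?thesis
      using T_lin J_lin by (simp add: complex_vector.subspace_def clinear_iff)
  qed
  ultimately show ?thesis by blast
qed

end
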